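(* Let $\mathcal{T}$ be a finite set with at least two threads and $\mathcal{X}$ a finite nonempty set of memory locations. For all runs $\sigma,\rho\in\Sigma^*$ with $\sigma\equiv_{\mathcal{M}}\rho$ we have $\sigma\rightsquigarrow_s^*\rho$. On the other hand, there exist runs $\sigma',\rho'\in\Sigma^*$ such that $\sigma'\rightsquigarrow_s^*\rho'$ but $\sigma'\not\equiv_{\mathcal{M}}\rho'$. Hence $\equiv_{\mathcal{M}}\ \subsetneq\ \rightsquigarrow_s^*$.
   Context: Given finite sets $\mathcal{T}$ (threads) and $\mathcal{X}$ (memory locations), let $\Sigma=\{\langle t,op(x)\rangle : t\in\mathcal{T},\ op\in\{\mathtt{w},\mathtt{r}\},\ x\in\mathcal{X}\}$ ($\mathtt{w}$ = write, $\mathtt{r}$ = read). A run is a finite word $\sigma\in\Sigma^*$; the occurrences of letters in it are its events. The reads-from map $\mathsf{rf}_\sigma$ is the partial map sending each read event on a location $x$ to the last write event on $x$ preceding it in $\sigma$, undefined if there is no such write. Reads-from equivalence: $\sigma\equiv_{\mathsf{rf}}\rho$ iff for every thread $t$ the subsequence of events of thread $t$ is the same in $\sigma$ and $\rho$ (same events and same program order; so the $j$-th event of thread $t$ in $\sigma$ is identified with the $j$-th event of thread $t$ in $\rho$), and, under this identification, $\mathsf{rf}_\sigma=\mathsf{rf}_\rho$. Sliced reordering: $\sigma\rightsquigarrow_s\rho$ iff $\sigma\equiv_{\mathsf{rf}}\rho$ and the events of $\sigma$ can be partitioned into two disjoint (possibly empty) subsequences $\sigma_1,\sigma_2$ of $\sigma$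 such that $\rho=\sigma_1\cdot\sigma_2$ as sequences of events (identifying, for every thread $t$ and every $j$, the $j$-th event of thread $t$ in $\sigma$ with the $j$-th event of thread $t$ in $\rho$). $\rightsquigarrow_s^*$ is the reflexive transitive closure of $\rightsquigarrow_s$. Trace equivalence $\equiv_{\mathcal{M}}$ is the smallest equivalence on $\Sigma^*$ such that $\tau_1\cdot e\cdot f\cdot\tau_2\equiv_{\mathcal{M}}\tau_1\cdot f\cdot e\cdot\tau_2$ whenever $(e,f)\in\mathbb{I}$, where $\mathbb{I}=\{(\langle t_1,op_1(x_1)\rangle,\langle t_2,op_2(x_2)\rangle) : t_1\neq t_2 \wedge (x_1=x_2\Rightarrow op_1=op_2=\mathtt{r})\}$. *)

theory Defs
  imports Main
begin

datatype access = W | R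

datatype ('t, 'x) letter = Letter (thread: 't) (kind: access) (loc: 'x)

type_synonym ('t, 'x) run = "('t, 'x) letter list"

definition Sigma_of :: "'t set \<Rightarrow> 'x set \<Rightarrow> ('t, 'x) letter set" where
  "Sigma_of T X = {a. thread a \<in> T \<and> loc a \<in> X}"

definition runs :: "'t set \<Rightarrow> 'x set \<Rightarrow> ('t, 'x) run set" where
  "runs T X = lists (Sigma_of T X)"

text \<open>
  The name \<open>(t, j)\<close> stands for the \<open>j\<close>-th event of thread \<open>t\<close>, with \<open>j\<close> counted from 0.
  Events of two runs are identified iff they have the same name.
  Only meaningful for \<open>i < length \<sigma>\<close>.
\<close>

definition event_at :: "('t, 'x) run \<Rightarrow> nat \<Rightarrow> 't \<times> nat" where
  "event_at \<sigma> i = (thread (\<sigma> ! i), card {k. k < i \<and> thread (\<sigma> ! k) = thread (\<sigma> ! i)})"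

definition events :: "('t, 'x) run \<Rightarrow> ('t \<times> nat) list" where
  "events \<sigma> = map (event_at \<sigma>) [0..<length \<sigma>]"

definition writes_before :: "('t, 'x) run \<Rightarrow> nat \<Rightarrow> nat set" where
  "writes_before \<sigma> i = {k. k < i \<and> kind (\<sigma> ! k) = W \<and> loc (\<sigma> ! k) = loc (\<sigma> ! i)}"

text \<open>The reads-from map, as a partial map on positions of \<open>\<sigma>\<close>.\<close>

definition rf :: "('t, 'x) run \<Rightarrow> nat \<rightharpoonup> nat" where
  "rf \<sigma> i = (if i < length \<sigma> \<and> kind (\<sigma> ! i) = R \<and> writes_before \<sigma> i \<noteq> {}
             then Some (Max (writes_before \<sigma> i)) else None)"

definition rf_equiv :: "'t set \<Rightarrow> 'x set \<Rightarrow> ('t, 'x) run rel" where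
  "rf_equiv T X = {(\<sigma>, \<rho>). \<sigma> \<in> runs T X \<and> \<rho> \<in> runs T X \<and>
     (\<forall>t\<in>T. filter (\<lambda>a. thread a = t) \<sigma> = filter (\<lambda>a. thread a = t) \<rho>) \<and>
     (\<forall>i<length \<sigma>. \<forall>j<length \<rho>. event_at \<sigma> i = event_at \<rho> j \<longrightarrow>
        map_option (event_at \<sigma>) (rf \<sigma> i) = map_option (event_at \<rho>) (rf \<rho> j))}"

text \<open>The set \<open>A\<close> collects the events of \<open>\<sigma>\<^sub>1\<close>; those of \<open>\<sigma>\<^sub>2\<close> are the remaining ones.\<close>

definition sliced :: "'t set \<Rightarrow> 'x set \<Rightarrow> ('t, 'x) run rel" where
  "sliced T X = {(\<sigma>, \<rho>). (\<sigma>, \<rho>) \<in> rf_equiv T X \<and>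
     (\<exists>A. events \<rho> = filter (\<lambda>e. e \<in> A) (events \<sigma>) @ filter (\<lambda>e. e \<notin> A) (events \<sigma>))}"

text \<open>
  The library's closure is reflexive on the whole type of letter lists; the intersection
  makes it the reflexive transitive closure on runs over \<open>T\<close> and \<open>X\<close>.
\<close>

definition sliced_star :: "'t set \<Rightarrow> 'x set \<Rightarrow> ('t, 'x) run rel" where
  "sliced_star T X = (sliced T X)\<^sup>* \<inter> (runs T X \<times> runs T X)"

definition indep :: "'t set \<Rightarrow> 'x set \<Rightarrow> ('t, 'x) letter rel" where
  "indep T X = {(a, b). a \<in> Sigma_of T X \<and> b \<in> Sigma_of T X \<and> thread a \<noteq> thread b \<and>
     (loc a = loc b \<longrightarrow> kind a = R \<and> kind b = R)}"

inductive_set trace_equiv :: "'t set \<Rightarrow> 'x set \<Rightarrow> ('t, 'x) run rel"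
  for T :: "'t set" and X :: "'x set" where
  swap: "\<lbrakk>\<tau>\<^sub>1 \<in> runs T X; \<tau>\<^sub>2 \<in> runs T X; (e, f) \<in> indep T X\<rbrakk>
    \<Longrightarrow> (\<tau>\<^sub>1 @ [e, f] @ \<tau>\<^sub>2, \<tau>\<^sub>1 @ [f, e] @ \<tau>\<^sub>2) \<in> trace_equiv T X"
| refl: "\<sigma> \<in> runs T X \<Longrightarrow> (\<sigma>, \<sigma>) \<in> trace_equiv T X"
| sym: "(\<sigma>, \<rho>) \<in> trace_equiv T X \<Longrightarrow> (\<rho>, \<sigma>) \<in> trace_equiv T X"
| trans: "\<lbrakk>(\<sigma>, \<rho>) \<in> trace_equiv T X; (\<rho>, \<tau>) \<in> trace_equiv T X\<rbrakk>
    \<Longrightarrow> (\<sigma>, \<tau>) \<in> trace_equiv T X"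

end

theory Submission
  imports Defs "HOL-Combinatorics.Transposition"
begin

text \<open>
  Swapping the independent letters in \<open>\<tau>\<^sub>1 e f \<tau>\<^sub>2\<close> is a single sliced reordering, with
  first slice \<open>\<tau>\<^sub>1 f\<close> and second slice \<open>e \<tau>\<^sub>2\<close>; it preserves reads-from because the transposition
  of positions is monotone on conflicting pairs of events. For strictness, two writes to the same
  location by different threads can be commuted by slicing, whereas trace equivalence preserves the
  order of the writes to a fixed location.
\<close>

lemma event_at_less:
  assumes "i < j" and "thread (\<sigma> ! i) = thread (\<sigma> ! j)"
  shows "snd (event_at \<sigma> i) < snd (event_at \<sigma> j)"
  unfolding event_at_def snd_conv
  by (rule psubset_card_mono) (use assms in auto)

text \<open>Within one thread the index grows strictly with the position. This holds even past the
  end of the run, where \<open>nth\<close> still denotes some fixed letter, so no range conditions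
  arise later.\<close>

lemma inj_event_at: "inj (event_at \<sigma>)"
proof (rule injI)
  fix i j assume eq: "event_at \<sigma> i = event_at \<sigma> j"
  then have "thread (\<sigma> ! i) = thread (\<sigma> ! j)"
    by (simp add: event_at_def)
  then show "i = j"
    using eq event_at_less[of i j \<sigma>] event_at_less[of j i \<sigma>]
    by (metis less_irrefl linorder_neqE_nat)
qed

text \<open>No position lies strictly between \<open>n\<close> and \<open>Suc n\<close>, so any
  third position compares in the same way with both.\<close>

lemma transpose_Suc_less_iff:
  assumes "{k, i} \<noteq> {n, Suc n}"
  shows "transpose n (Suc n) k < transpose n (Suc n) i \<longleftrightarrow> k < i"
  using assms by (auto simp: transpose_def doubleton_eq_iff)

lemma involution_image:
  assumes "\<And>k. h (h k) = k" and "\<And>k. k \<in> A \<longleftrightarrow> h k \<in> B"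
  shows "A = h ` B"
proof -
  have "k \<in> h ` B" if "h k \<in> B" for k
    using image_eqI[OF _ that, of k h] by (simp add: assms(1))
  moreover have "h k \<in> A" if "k \<in> B" for k
    using that by (simp only: assms)
  ultimately show ?thesis
    using assms(2) by blast
qed

text \<open>Both assumptions are symmetric in \<open>e\<close> and \<open>f\<close>, so the locale
  can be interpreted in either order, which yields both directions of a swap.\<close>

locale independent_swap =
  fixes \<tau>\<^sub>1 \<tau>\<^sub>2 :: "('t, 'x) run" and e f :: "('t, 'x) letter"
  assumes thread_neq: "thread e \<noteq> thread f"
    and reads: "loc e = loc f \<Longrightarrow> kind e = R \<and> kind f = R"
begin

definition "src = \<tau>\<^sub>1 @ [e, f] @ \<tau>\<^sub>2"
definition "tgt = \<tau>\<^sub>1 @ [f, e] @ \<tau>\<^sub>2"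
abbreviation "n \<equiv> length \<tau>\<^sub>1"
abbreviation "p \<equiv> transpose n (Suc n)"

lemma length_src [simp]: "length src = length tgt"
  by (simp add: src_def tgt_def)

lemma nth_src: "src ! n = e" "src ! Suc n = f"
  by (simp_all add: src_def nth_append)

lemma nth_tgt: "tgt ! i = src ! p i"
proof (cases "i = n \<or> i = Suc n")
  case True
  then show ?thesis by (auto simp: src_def tgt_def nth_append)
next
  case False
  then have "i < n \<or> (\<exists>k. i = n + Suc (Suc k))"
    by presburger
  with False show ?thesis by (auto simp: src_def tgt_def nth_append transpose_def)
qed

text \<open>The map \<open>p\<close> reverses only the pair of positions holding \<open>e\<close>
  and \<open>f\<close>, which \<open>Q\<close> does not relate. Taking \<open>Q\<close> to be
  equality of threads handles event names; taking it to be "the second letter is a write to the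
  location of the first" handles \<open>writes_before\<close>.\<close>

lemma before_tgt:
  assumes "\<not> Q e f" and "\<not> Q f e"
  shows "{k. k < i \<and> Q (tgt ! i) (tgt ! k)} = p ` {k. k < p i \<and> Q (src ! p i) (src ! k)}"
proof -
  have "k < i \<longleftrightarrow> p k < p i" if "Q (src ! p i) (src ! p k)" for k
  proof -
    have "\<not> (k = n \<and> i = Suc n)" "\<not> (k = Suc n \<and> i = n)"
      using that assms by (auto simp: nth_src)
    then have "{k, i} \<noteq> {n, Suc n}"
      unfolding doubleton_eq_iff by blast
    then show ?thesis by (rule transpose_Suc_less_iff[symmetric])
  qed
  then have iff: "k \<in> {k. k < i \<and> Q (tgt ! i) (tgt ! k)}
      \<longleftrightarrow> p k \<in> {k. k < p i \<and> Q (src ! p i) (src ! k)}" for k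
    unfolding nth_tgt mem_Collect_eq by blast
  show ?thesis
    by (rule involution_image[OF transpose_involutory iff])
qed

lemma event_at_tgt: "event_at tgt i = event_at src (p i)"
proof -
  have "{k. k < i \<and> thread (tgt ! k) = thread (tgt ! i)}
      = p ` {k. k < p i \<and> thread (src ! k) = thread (src ! p i)}"
    by (rule before_tgt) (use thread_neq in auto)
  then show ?thesis
    by (simp add: event_at_def nth_tgt card_image)
qed

lemma writes_before_tgt: "writes_before tgt i = p ` writes_before src (p i)"
  unfolding writes_before_def
  by (rule before_tgt) (use reads in auto)

lemma Max_writes_before_tgt:
  assumes "writes_before src i \<noteq> {}"
  shows "Max (p ` writes_before src i) = p (Max (writes_before src i))"
proof -
  let ?S = "writes_before src i"
  have fin: "finite ?S" by (simp add: writes_before_def)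
  note M = Max_in[OF fin assms]
  have "p k \<le> p (Max ?S)" if k: "k \<in> ?S" for k
  proof (cases "k = Max ?S")
    case False
    \<comment> \<open>Otherwise \<open>e\<close> and \<open>f\<close> would both be writes to one
      location, but independent letters sharing a location are reads. Hence \<open>p\<close> is
      monotone on \<open>?S\<close> and commutes with \<open>Max\<close>.\<close>
    have "\<not> (n \<in> ?S \<and> Suc n \<in> ?S)"
      using reads by (auto simp: writes_before_def nth_src)
    then have "{k, Max ?S} \<noteq> {n, Suc n}"
      using k M by (auto simp: doubleton_eq_iff)
    moreover have "k < Max ?S"
      using False Max_ge[OF fin k] by simp
    ultimately show ?thesis
      using transpose_Suc_less_iff[of k "Max ?S" n] by simp
  qed simp
  then show ?thesis
    using M fin by (intro Max_eqI) auto
qed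

lemma rf_tgt: "rf tgt i = map_option p (rf src (p i))"
proof -
  \<comment> \<open>The two positions moved by \<open>p\<close> are both in range, so
    \<open>rf\<close> falls back to \<open>None\<close> beyond the end for both runs alike.\<close>
  have "i < length tgt \<longleftrightarrow> p i < length src"
    by (auto simp: transpose_def tgt_def)
  then show ?thesis
    by (simp add: rf_def nth_tgt writes_before_tgt Max_writes_before_tgt)
qed

lemma rf_equiv_swap:
  assumes "src \<in> runs T X"
  shows "(src, tgt) \<in> rf_equiv T X"
proof -
  have "tgt \<in> runs T X"
    using assms by (simp add: runs_def src_def tgt_def)
  moreover have "filter (\<lambda>a. thread a = t) src = filter (\<lambda>a. thread a = t) tgt" for t
    using thread_neq by (auto simp: src_def tgt_def)
  moreover have "map_option (event_at src) (rf src i) = map_option (event_at tgt) (rf tgt j)"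
    if "event_at src i = event_at tgt j" for i j
  proof -
    \<comment> \<open>Names determine positions, so identified events are exactly those matched by
      \<open>p\<close>.\<close>
    have "i = p j"
      using that inj_event_at[of src] unfolding event_at_tgt by (meson injD)
    then show ?thesis
      by (simp add: rf_tgt option.map_comp comp_def event_at_tgt)
  qed
  ultimately show ?thesis
    using assms unfolding rf_equiv_def by blast
qed

lemma events_swap:
  defines "A \<equiv> event_at src ` ({..<n} \<union> {Suc n})"
  shows "events tgt = filter (\<lambda>a. a \<in> A) (events src) @ filter (\<lambda>a. a \<notin> A) (events src)"
proof -
  let ?N = "length src"
  have split: "[0..<?N] = [0..<n] @ [n, Suc n] @ [Suc (Suc n)..<?N]"
    using upt_add_eq_append[of 0 n "Suc (Suc (length \<tau>\<^sub>2))"]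
    by (simp add: src_def upt_conv_Cons del: upt_Suc)
  \<comment> \<open>Injectivity turns membership of a name in \<open>A\<close> into a condition on
    its position, so the slicing can be computed on the list of indices.\<close>
  have mem: "event_at src i \<in> A \<longleftrightarrow> i < n \<or> i = Suc n" for i
    unfolding A_def by (subst inj_image_mem_iff[OF inj_event_at]) auto
  have "events tgt = map (event_at src) (map p [0..<?N])"
    by (simp add: events_def event_at_tgt del: upt_Suc)
  also have "map p [0..<?N] = [0..<n] @ [Suc n, n] @ [Suc (Suc n)..<?N]"
    unfolding split by (auto simp: transpose_def intro!: map_idI)
  also have "\<dots> = filter (\<lambda>i. i < n \<or> i = Suc n) [0..<?N]
      @ filter (\<lambda>i. \<not> (i < n \<or> i = Suc n)) [0..<?N]"
    unfolding split by (simp add: filter_empty_conv filter_id_conv)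
  finally show ?thesis
    by (simp add: events_def filter_map comp_def mem del: upt_Suc)
qed

lemma sliced_swap: "src \<in> runs T X \<Longrightarrow> (src, tgt) \<in> sliced T X"
  unfolding sliced_def using rf_equiv_swap events_swap by blast

end

lemma trace_equiv_runs:
  assumes "(\<sigma>, \<rho>) \<in> trace_equiv T X"
  shows "\<sigma> \<in> runs T X \<and> \<rho> \<in> runs T X"
  using assms by induction (auto simp: runs_def indep_def)

text \<open>The converse closure is carried along because \<open>sliced\<close> itself is not symmetric.\<close>

lemma trace_equiv_imp_sliced_rtrancl:
  assumes "(\<sigma>, \<rho>) \<in> trace_equiv T X"
  shows "(\<sigma>, \<rho>) \<in> (sliced T X)\<^sup>* \<and> (\<rho>, \<sigma>) \<in> (sliced T X)\<^sup>*"
  using assms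
proof induction
  case (swap \<tau>\<^sub>1 \<tau>\<^sub>2 e f)
  interpret ef: independent_swap \<tau>\<^sub>1 \<tau>\<^sub>2 e f
    using swap by unfold_locales (auto simp: indep_def)
  interpret fe: independent_swap \<tau>\<^sub>1 \<tau>\<^sub>2 f e
    using swap by unfold_locales (auto simp: indep_def)
  have "\<tau>\<^sub>1 @ [e, f] @ \<tau>\<^sub>2 \<in> runs T X" "\<tau>\<^sub>1 @ [f, e] @ \<tau>\<^sub>2 \<in> runs T X"
    using swap by (auto simp: runs_def indep_def)
  then show ?case
    using ef.sliced_swap fe.sliced_swap
    unfolding ef.src_def ef.tgt_def fe.src_def fe.tgt_def by blast
qed (auto intro: rtrancl_trans)

text \<open>Of two independent letters at most one is a write to \<open>x\<close>, so no swap
  affects the filtered list. This invariant separates the two relations.\<close>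

lemma trace_equiv_filter_writes:
  assumes "(\<sigma>, \<rho>) \<in> trace_equiv T X"
  shows "filter (\<lambda>a. kind a = W \<and> loc a = x) \<sigma> = filter (\<lambda>a. kind a = W \<and> loc a = x) \<rho>"
  using assms by induction (auto simp: indep_def)

lemma sliced_writes:
  assumes "s \<in> T" "t \<in> T" "s \<noteq> t" "x \<in> X"
  shows "([Letter s W x, Letter t W x], [Letter t W x, Letter s W x]) \<in> sliced T X"
proof -
  let ?\<sigma> = "[Letter s W x, Letter t W x]" and ?\<rho> = "[Letter t W x, Letter s W x]"
  have no_rf: "rf ?\<sigma> i = None" "rf ?\<rho> i = None" for i
    by (auto simp: rf_def less_Suc_eq nth_Cons')
  have "(?\<sigma>, ?\<rho>) \<in> rf_equiv T X"
    using assms by (auto simp: rf_equiv_def no_rf runs_def Sigma_of_def)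
  \<comment> \<open>The second event of each run has its only predecessor in the other thread, so
    its index is 0.\<close>
  moreover have "{k. k = 0 \<and> thread (?\<sigma> ! k) = t} = {}" "{k. k = 0 \<and> thread (?\<rho> ! k) = s} = {}"
    using assms by auto
  then have "events ?\<sigma> = [(s, 0), (t, 0)]" "events ?\<rho> = [(t, 0), (s, 0)]"
    by (simp_all add: events_def event_at_def)
  \<comment> \<open>The first slice is the single write of \<open>t\<close>, which thereby overtakes
    the write of \<open>s\<close>.\<close>
  then have "events ?\<rho> = filter (\<lambda>a. a \<in> {(t, 0)}) (events ?\<sigma>) @ filter (\<lambda>a. a \<notin> {(t, 0)}) (events ?\<sigma>)"
    using assms by simp
  ultimately show ?thesis unfolding sliced_def by blast
qed

theorem theorem4p1:
  fixes T :: "'t set" and X :: "'x set"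
  assumes "finite T" and "card T \<ge> 2" and "finite X" and "X \<noteq> {}"
  shows "(\<forall>\<sigma>\<in>runs T X. \<forall>\<rho>\<in>runs T X.
            (\<sigma>, \<rho>) \<in> trace_equiv T X \<longrightarrow> (\<sigma>, \<rho>) \<in> sliced_star T X) \<and>
         (\<exists>\<sigma>'\<in>runs T X. \<exists>\<rho>'\<in>runs T X.
            (\<sigma>', \<rho>') \<in> sliced_star T X \<and> (\<sigma>', \<rho>') \<notin> trace_equiv T X) \<and>
         trace_equiv T X \<subset> sliced_star T X"
proof -
  have sub: "trace_equiv T X \<subseteq> sliced_star T X"
    using trace_equiv_imp_sliced_rtrancl trace_equiv_runs by (fastforce simp: sliced_star_def)
  obtain s t where st: "s \<in> T" "t \<in> T" "s \<noteq> t"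
    using assms(1,2) card_le_Suc0_iff_eq[of T] by fastforce
  obtain x where x: "x \<in> X" using assms(4) by blast
  let ?\<sigma> = "[Letter s W x, Letter t W x]" and ?\<rho> = "[Letter t W x, Letter s W x]"
  have r: "?\<sigma> \<in> runs T X" "?\<rho> \<in> runs T X"
    using st x by (auto simp: runs_def Sigma_of_def)
  have star: "(?\<sigma>, ?\<rho>) \<in> sliced_star T X"
    using sliced_writes[OF st x] r by (auto simp: sliced_star_def)
  have "(?\<sigma>, ?\<rho>) \<notin> trace_equiv T X"
    using trace_equiv_filter_writes[of ?\<sigma> ?\<rho> T X x] st by auto
  then show ?thesis
    using sub r star by blast
qed

end
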